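(* Let $R$ be a commutative Noetherian ring of prime characteristic $p>0$ and Krull dimension $d>0$. (1) For all ideals $\mathfrak{a}, I\subseteq R$ we have $I^*\subseteq {}^{\mathfrak{a}}I^*\subseteq I^{*\mathfrak{a}}$. (2) If $\mathfrak{a}=(f)$ is a principal ideal, then $I^{*\mathfrak{a}}=I^*:f$. In particular, $(I^{*(f)})^{*(f)}\neq I^{*(f)}$ when $(R,\mathfrak{m})$ is local, $I$ is $\mathfrak{m}$-primary, and $f\in\mathfrak{m}\setminus I$. (3) If $\mathfrak{a}=(f)$ is a principal ideal and $f$ is a non-zerodivisor on $R$, then ${}^{\mathfrak{a}}I^*=I^*$. (4) For all ideals $\mathfrak{a}$ and $I$, ${}^{\mathfrak{a}}\left({}^{\mathfrak{a}}I^*\right)^*={}^{\mathfrak{a}}I^*$. In other words, $I\mapsto {}^{\mathfrak{a}}I^*$ is a true closure operation.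
   Context: $q=p^e$ always denotes a power of $p$. $R^o$ is the set of elements of $R$ not in any minimal prime of $R$. For an ideal $I$, $I^{[q]}$ is the ideal generated by all $i^q$ with $i\in I$; $\mathfrak{a}^q$ is the ordinary power. Definitions, for $x\in R$ and ideals $\mathfrak{a},I\subseteq R$: - $x\in I^{*\mathfrak{a}}$ (Hara-Yoshida $\mathfrak{a}$-tight closure) if there is $c\in R^o$ with $c\,\mathfrak{a}^q x^q\subseteq I^{[q]}$ for all $q=p^e\gg 0$. - $x\in {}^{\mathfrak{a}}I^*$ if there is $c\in R^o$ with $c\,\mathfrak{a}^q x^q\subseteq \mathfrak{a}^q I^{[q]}$ for all $q=p^e\gg 0$. - $I^*$ is the usual tight closure, which is the common value of both for $\mathfrak{a}=R$.
   Formalization: In the second sentence of (2), the hypothesis f in m \ I is replaced by f in m \ I^*, because for f in I^* \ I one has I^{*(f)} = R and equality holds (e.g. R = k[[t^2,t^3]], I = (t^2), f = t^3). *)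

theory Defs
  imports "HOL-Algebra.Algebra" "HOL-Library.Extended_Nat"
begin

definition ring_characteristic :: "('a, 'b) ring_scheme \<Rightarrow> nat" where
  "ring_characteristic R = group.ord (add_monoid R) \<one>\<^bsub>R\<^esub>"

text \<open>Supremum of the lengths of strict chains of prime ideals.  It is \<open>\<infinity>\<close> if the lengths
  are unbounded and \<open>0\<close> for the zero ring.\<close>

definition krull_dim :: "('a, 'b) ring_scheme \<Rightarrow> enat" where
  "krull_dim R = Sup {enat n | n. \<exists>P. (\<forall>i\<le>n. primeideal (P i) R) \<and> (\<forall>i<n. P i \<subset> P (Suc i))}"

definition minimal_prime :: "'a set \<Rightarrow> ('a, 'b) ring_scheme \<Rightarrow> bool" where
  "minimal_prime P R \<longleftrightarrow> primeideal P R \<and> (\<forall>Q. primeideal Q R \<and> Q \<subseteq> P \<longrightarrow> Q = P)"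

text \<open>The set \<open>R\<^sup>o\<close>.\<close>

definition off_minimal_primes :: "('a, 'b) ring_scheme \<Rightarrow> 'a set" where
  "off_minimal_primes R = {c \<in> carrier R. \<forall>P. minimal_prime P R \<longrightarrow> c \<notin> P}"

definition local_ring :: "('a, 'b) ring_scheme \<Rightarrow> 'a set \<Rightarrow> bool" where
  "local_ring R \<mm> \<longleftrightarrow> cring R \<and> maximalideal \<mm> R \<and> (\<forall>\<nn>. maximalideal \<nn> R \<longrightarrow> \<nn> = \<mm>)"

definition ideal_radical :: "('a, 'b) ring_scheme \<Rightarrow> 'a set \<Rightarrow> 'a set" where
  "ideal_radical R I = {x \<in> carrier R. \<exists>n::nat. x [^]\<^bsub>R\<^esub> n \<in> I}"

definition primary_ideal :: "'a set \<Rightarrow> ('a, 'b) ring_scheme \<Rightarrow> bool" where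
  "primary_ideal I R \<longleftrightarrow> ideal I R \<and> I \<noteq> carrier R \<and>
     (\<forall>x\<in>carrier R. \<forall>y\<in>carrier R. x \<otimes>\<^bsub>R\<^esub> y \<in> I \<longrightarrow> x \<in> I \<or> y \<in> ideal_radical R I)"

text \<open>\<open>I\<close> is \<open>P\<close>-primary.\<close>

definition primary_to :: "('a, 'b) ring_scheme \<Rightarrow> 'a set \<Rightarrow> 'a set \<Rightarrow> bool" where
  "primary_to R P I \<longleftrightarrow> primary_ideal I R \<and> ideal_radical R I = P"

definition nonzerodivisor :: "('a, 'b) ring_scheme \<Rightarrow> 'a \<Rightarrow> bool" where
  "nonzerodivisor R f \<longleftrightarrow>
     f \<in> carrier R \<and> (\<forall>x\<in>carrier R. f \<otimes>\<^bsub>R\<^esub> x = \<zero>\<^bsub>R\<^esub> \<longrightarrow> x = \<zero>\<^bsub>R\<^esub>)"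

definition colon :: "('a, 'b) ring_scheme \<Rightarrow> 'a set \<Rightarrow> 'a \<Rightarrow> 'a set" where
  "colon R I f = {x \<in> carrier R. x \<otimes>\<^bsub>R\<^esub> f \<in> I}"

definition ideal_power :: "('a, 'b) ring_scheme \<Rightarrow> 'a set \<Rightarrow> nat \<Rightarrow> 'a set" where
  "ideal_power R I n = I [^]\<^bsub>ideals_set R\<^esub> n"

text \<open>The bracket power \<open>I\<^bsup>[q]\<^esup>\<close>.\<close>

definition bracket_power :: "('a, 'b) ring_scheme \<Rightarrow> 'a set \<Rightarrow> nat \<Rightarrow> 'a set" where
  "bracket_power R I q = Idl\<^bsub>R\<^esub> ((\<lambda>i. i [^]\<^bsub>R\<^esub> q) ` I)"

text \<open>In the three closures below, \<open>p\<close> is the characteristic of \<open>R\<close>, and \<open>q = p ^ e \<ggreater> 0\<close> is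
  rendered as ``for all sufficiently large \<open>e\<close>''.\<close>

definition tight_closure :: "('a, 'b) ring_scheme \<Rightarrow> nat \<Rightarrow> 'a set \<Rightarrow> 'a set" where
  "tight_closure R p I = {x \<in> carrier R. \<exists>c\<in>off_minimal_primes R.
     \<forall>\<^sub>F e in sequentially. c \<otimes>\<^bsub>R\<^esub> x [^]\<^bsub>R\<^esub> (p ^ e) \<in> bracket_power R I (p ^ e)}"

text \<open>The Hara--Yoshida closure \<open>I\<^bsup>*\<aa>\<^esup>\<close>.\<close>

definition hy_closure :: "('a, 'b) ring_scheme \<Rightarrow> nat \<Rightarrow> 'a set \<Rightarrow> 'a set \<Rightarrow> 'a set" where
  "hy_closure R p \<aa> I = {x \<in> carrier R. \<exists>c\<in>off_minimal_primes R.
     \<forall>\<^sub>F e in sequentially. (\<lambda>b. c \<otimes>\<^bsub>R\<^esub> b \<otimes>\<^bsub>R\<^esub> x [^]\<^bsub>R\<^esub> (p ^ e)) ` ideal_power R \<aa> (p ^ e)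
       \<subseteq> bracket_power R I (p ^ e)}"

text \<open>The closure \<open>\<^sup>\<aa>I\<^sup>*\<close>.\<close>

definition left_closure :: "('a, 'b) ring_scheme \<Rightarrow> nat \<Rightarrow> 'a set \<Rightarrow> 'a set \<Rightarrow> 'a set" where
  "left_closure R p \<aa> I = {x \<in> carrier R. \<exists>c\<in>off_minimal_primes R.
     \<forall>\<^sub>F e in sequentially. (\<lambda>b. c \<otimes>\<^bsub>R\<^esub> b \<otimes>\<^bsub>R\<^esub> x [^]\<^bsub>R\<^esub> (p ^ e)) ` ideal_power R \<aa> (p ^ e)
       \<subseteq> ideal_power R \<aa> (p ^ e) \<cdot>\<^bsub>R\<^esub> bracket_power R I (p ^ e)}"

definition closure_operation :: "('a, 'b) ring_scheme \<Rightarrow> ('a set \<Rightarrow> 'a set) \<Rightarrow> bool" where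
  "closure_operation R cl \<longleftrightarrow>
     (\<forall>I. ideal I R \<longrightarrow> ideal (cl I) R \<and> I \<subseteq> cl I \<and> cl (cl I) = cl I) \<and>
     (\<forall>I J. ideal I R \<and> ideal J R \<and> I \<subseteq> J \<longrightarrow> cl I \<subseteq> cl J)"


text \<open>Both closures specialise to tight closure for the unit ideal.\<close>

lemma (in cring) ideal_prod_carrier_left:
  assumes "ideal J R" shows "carrier R \<cdot> J = J"
  using assms ideal_prod_one oneideal ideal_prod_commute by metis

lemma (in cring) ideal_power_carrier: "ideal_power R (carrier R) n = carrier R"
proof (induction n)
  case 0
  show ?case by (simp add: ideal_power_def nat_pow_def ideals_set_def)
next
  case (Suc n)
  then show ?case
    using ideal_prod_carrier_left[OF oneideal]
    by (simp add: ideal_power_def nat_pow_def ideals_set_def)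
qed

lemma (in cring) bracket_power_ideal:
  assumes "ideal I R" shows "ideal (bracket_power R I q) R"
  unfolding bracket_power_def
  by (rule genideal_ideal) (use ideal.Icarr[OF assms] in auto)

lemma (in cring) unit_ideal_image_iff:
  assumes "ideal K R" "c \<in> carrier R" "y \<in> carrier R"
  shows "(\<lambda>b. c \<otimes> b \<otimes> y) ` carrier R \<subseteq> K \<longleftrightarrow> c \<otimes> y \<in> K"
proof
  assume "(\<lambda>b. c \<otimes> b \<otimes> y) ` carrier R \<subseteq> K"
  then have "c \<otimes> \<one> \<otimes> y \<in> K" by blast
  then show "c \<otimes> y \<in> K" using assms by simp
next
  assume *: "c \<otimes> y \<in> K"
  have "c \<otimes> b \<otimes> y \<in> K" if "b \<in> carrier R" for b
  proof -
    have "c \<otimes> b \<otimes> y = b \<otimes> (c \<otimes> y)" using that assms by (simp add: m_ac)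
    then show ?thesis using ideal.I_l_closed[OF assms(1) * that] by simp
  qed
  then show "(\<lambda>b. c \<otimes> b \<otimes> y) ` carrier R \<subseteq> K" by blast
qed

lemma (in cring) hy_closure_carrier:
  assumes "ideal I R" shows "hy_closure R p (carrier R) I = tight_closure R p I"
  unfolding hy_closure_def tight_closure_def
  by (intro Collect_cong conj_cong refl bex_cong)
    (simp add: ideal_power_carrier unit_ideal_image_iff[OF bracket_power_ideal[OF assms]]
      off_minimal_primes_def)

lemma (in cring) left_closure_carrier:
  assumes "ideal I R" shows "left_closure R p (carrier R) I = tight_closure R p I"
  unfolding left_closure_def tight_closure_def
  by (intro Collect_cong conj_cong refl bex_cong)
    (simp add: ideal_power_carrier unit_ideal_image_iff[OF bracket_power_ideal[OF assms]]
      ideal_prod_carrier_left[OF bracket_power_ideal[OF assms]] off_minimal_primes_def)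

end

theory Submission
  imports Defs
begin

text \<open>By the Frobenius homomorphism, for fixed \<open>c\<close> and \<open>e\<close> the elements \<open>x\<close> with
  \<open>c \<aa>\<^sup>q x\<^sup>q \<subseteq> \<aa>\<^sup>q I\<^bsup>[q]\<^esup>\<close> (where \<open>q = p\<^sup>e\<close>) form an ideal.  As \<open>R\<^sup>o\<close> is multiplicatively
  closed, one \<open>c\<close> serves finitely many \<open>x\<close>, hence all of \<open>J = \<^sup>\<aa>I\<^sup>*\<close> if \<open>R\<close> is Noetherian: there is
  \<open>d\<close> with \<open>d \<aa>\<^sup>q J\<^bsup>[q]\<^esup> \<subseteq> \<aa>\<^sup>q I\<^bsup>[q]\<^esup>\<close> for \<open>q \<ggreater> 0\<close>, and idempotence follows.  For a principal ideal
  \<open>\<aa>\<^sup>q\<close> is generated by \<open>f\<^sup>q\<close>, which is absorbed into \<open>x\<^sup>q\<close> or cancelled.  If \<open>n\<close> is least with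
  \<open>f\<^sup>n \<in> I\<^sup>*\<close> and \<open>n \<ge> 2\<close>, then \<open>f\<^bsup>n-2\<^esup>\<close> lies in \<open>(I\<^sup>*:f)\<^sup>*:f\<close> but not in \<open>I\<^sup>*:f\<close>.\<close>

section \<open>Commutative rings: binomial theorem, ideal products, colons and principal
  powers\<close>

context cring
begin

lemma ideal_of_closed:
  assumes "K \<subseteq> carrier R" "\<zero> \<in> K" "\<And>x y. x \<in> K \<Longrightarrow> y \<in> K \<Longrightarrow> x \<oplus> y \<in> K"
    "\<And>x r. x \<in> K \<Longrightarrow> r \<in> carrier R \<Longrightarrow> r \<otimes> x \<in> K"
  shows "ideal K R"
proof (rule idealI)
  show "ring R" by (rule ring_axioms)
  show "subgroup K (add_monoid R)"
  proof (rule add.subgroupI)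
    show "\<ominus> x \<in> K" if "x \<in> K" for x
    proof -
      have "\<ominus> x = (\<ominus> \<one>) \<otimes> x" using that assms(1) by (auto simp: l_minus)
      then show ?thesis using assms(4)[OF that, of "\<ominus> \<one>"] by simp
    qed
  qed (use assms in auto)
  show "r \<otimes> x \<in> K" "x \<otimes> r \<in> K" if "x \<in> K" "r \<in> carrier R" for x r
    using assms(4)[OF that] that assms(1) m_comm by (auto simp: subset_iff)
qed

text \<open>Induction by Pascal's rule: both parts of the product with a \<oplus> b are indexed so
  that the coefficients at k and \<open>Suc k\<close> meet on the same monomial.\<close>

lemma binomial_expansion:
  fixes n :: nat
  assumes [simp]: "a \<in> carrier R" "b \<in> carrier R"
  shows "(a \<oplus> b) [^] n = (\<Oplus>k\<in>{..n}. add_pow R (n choose k) (a [^] k \<otimes> b [^] (n - k)))"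
proof (induction n)
  case 0
  show ?case by simp
next
  case (Suc n)
  let ?S = "\<Oplus>k\<in>{..n}. add_pow R (n choose k) (a [^] k \<otimes> b [^] (n - k))"
  let ?T = "\<lambda>k. a [^] Suc k \<otimes> b [^] (n - k)"
  have A: "?S \<otimes> a = (\<Oplus>k\<in>{..n}. add_pow R (n choose k) (?T k))"
    by (subst finsum_ldistr) (auto intro!: finsum_cong' simp: add_pow_ldistr add_pow_rdistr m_ac)
  have "?S \<otimes> b = (\<Oplus>k\<in>{..n}. add_pow R (n choose k) (a [^] k \<otimes> b [^] (Suc n - k)))"
    by (subst finsum_ldistr) (auto intro!: finsum_cong' simp: add_pow_ldistr add_pow_rdistr m_ac Suc_diff_le)
  \<comment> \<open>The added summand k = n + 1 has coefficient 0; the longer range lets the summand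
    k = 0 be split off next.\<close>
  also have "\<dots> = (\<Oplus>k\<in>{..Suc n}. add_pow R (n choose k) (a [^] k \<otimes> b [^] (Suc n - k)))"
    by (subst finsum_Suc) (auto simp: binomial_eq_0)
  also have "\<dots> = (\<Oplus>k\<in>{..n}. add_pow R (n choose Suc k) (?T k)) \<oplus> b [^] Suc n"
    by (subst finsum_Suc2) auto
  finally have B: "?S \<otimes> b = (\<Oplus>k\<in>{..n}. add_pow R (n choose Suc k) (?T k)) \<oplus> b [^] Suc n" .
  have "(\<Oplus>k\<in>{..Suc n}. add_pow R (Suc n choose k) (a [^] k \<otimes> b [^] (Suc n - k)))
      = (\<Oplus>k\<in>{..n}. add_pow R (Suc n choose Suc k) (?T k)) \<oplus> b [^] Suc n"
    by (subst finsum_Suc2) auto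
  also have "(\<Oplus>k\<in>{..n}. add_pow R (Suc n choose Suc k) (?T k))
      = (\<Oplus>k\<in>{..n}. add_pow R (n choose k) (?T k) \<oplus> add_pow R (n choose Suc k) (?T k))"
    by (intro finsum_cong') (auto simp: add.nat_pow_mult)
  also have "\<dots> = ?S \<otimes> a \<oplus> (\<Oplus>k\<in>{..n}. add_pow R (n choose Suc k) (?T k))"
    unfolding A by (intro finsum_addf) auto
  finally have "(\<Oplus>k\<in>{..Suc n}. add_pow R (Suc n choose k) (a [^] k \<otimes> b [^] (Suc n - k)))
      = ?S \<otimes> a \<oplus> ?S \<otimes> b"
    unfolding B by (subst a_assoc[symmetric]) (auto simp del: nat_pow_Suc binomial_Suc_Suc)
  moreover have "(a \<oplus> b) [^] Suc n = ?S \<otimes> a \<oplus> ?S \<otimes> b"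
    using Suc by (simp add: r_distr)
  ultimately show ?case by simp
qed

lemma ideal_power_ideal:
  assumes "ideal \<aa> R" shows "ideal (ideal_power R \<aa> n) R"
proof (induction n)
  case 0
  show ?case by (simp add: ideal_power_def nat_pow_def ideals_set_def oneideal)
next
  case (Suc n)
  then show ?case
    using ideal_prod_is_ideal[OF _ assms]
    by (simp add: ideal_power_def nat_pow_def ideals_set_def)
qed

text \<open>An element of an ideal product is a sum of products. With a principal factor such a sum
  collapses to a single multiple of g, which is what makes cancelling g possible later.\<close>

lemma cgenideal_ideal_prod:
  assumes g: "g \<in> carrier R" and K: "ideal K R"
  shows "(PIdl g) \<cdot> K = (\<lambda>k. g \<otimes> k) ` K"
proof
  show "(PIdl g) \<cdot> K \<subseteq> (\<lambda>k. g \<otimes> k) ` K"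
  proof
    fix s assume "s \<in> (PIdl g) \<cdot> K"
    then show "s \<in> (\<lambda>k. g \<otimes> k) ` K"
    proof induct
      case (prod i j)
      then obtain x where x: "x \<in> carrier R" "i = x \<otimes> g" by (auto simp: cgenideal_def)
      then have "i \<otimes> j = g \<otimes> (x \<otimes> j)" using g ideal.Icarr[OF K prod(2)] by (simp add: m_ac)
      then show ?case using ideal.I_l_closed[OF K prod(2) x(1)] by blast
    next
      case (sum s t)
      then obtain k l where "k \<in> K" "l \<in> K" "s = g \<otimes> k" "t = g \<otimes> l" by blast
      then show ?case
        using g ideal.Icarr[OF K] additive_subgroup.a_closed[OF ideal.axioms(1)[OF K]]
        by (auto simp: r_distr[symmetric])
    qed
  qed
  show "(\<lambda>k. g \<otimes> k) ` K \<subseteq> (PIdl g) \<cdot> K"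
    using cgenideal_self[OF g] by (auto intro: ideal_prod.prod)
qed

lemma ideal_power_cgenideal:
  assumes f: "f \<in> carrier R" shows "ideal_power R (PIdl f) n = PIdl (f [^] n)"
proof (induction n)
  case 0
  \<comment> \<open>The zeroth power of an ideal is the whole ring, the unit of
    \<open>ideals_set\<close>.\<close>
  have "PIdl \<one> = carrier R"
    using cgenideal_ideal cgenideal_self ideal.one_imp_carrier one_closed by blast
  then show ?case by (simp add: ideal_power_def nat_pow_def ideals_set_def)
next
  case (Suc n)
  have "ideal_power R (PIdl f) (Suc n) = (PIdl (f [^] n)) \<cdot> (PIdl f)"
    using Suc by (simp add: ideal_power_def nat_pow_def ideals_set_def)
  also have "\<dots> = (\<lambda>k. f [^] n \<otimes> k) ` (PIdl f)"
    using f by (simp add: cgenideal_ideal_prod cgenideal_ideal)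
  also have "\<dots> = PIdl (f [^] Suc n)"
    using f by (fastforce simp: cgenideal_def image_iff m_ac)
  finally show ?case .
qed

text \<open>Lets a containment of c L in K be rephrased as a containment of L in an ideal, which can
  be tested on generators of L.\<close>

lemma ideal_colon:
  assumes K: "ideal K R" and c: "c \<in> carrier R"
  shows "ideal (colon R K c) R"
proof (rule ideal_of_closed)
  interpret K: ideal K R by (rule K)
  show "x \<oplus> y \<in> colon R K c" if "x \<in> colon R K c" "y \<in> colon R K c" for x y
    using that c by (simp add: colon_def l_distr)
  show "r \<otimes> x \<in> colon R K c" if "x \<in> colon R K c" "r \<in> carrier R" for x r
    using that c by (simp add: colon_def m_assoc K.I_l_closed)
qed (use c additive_subgroup.zero_closed[OF ideal.axioms(1)[OF K]] in \<open>auto simp: colon_def\<close>)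

text \<open>The generator g suffices as a test, since K absorbs the factor x of any other x g. The
  order y g is chosen so that x^q f^q can be read as (x f)^q.\<close>

lemma principal_image_subset_iff:
  assumes K: "ideal K R" and c: "c \<in> carrier R" "g \<in> carrier R" "y \<in> carrier R"
  shows "(\<lambda>b. c \<otimes> b \<otimes> y) ` (PIdl g) \<subseteq> K \<longleftrightarrow> c \<otimes> (y \<otimes> g) \<in> K"
proof
  assume "(\<lambda>b. c \<otimes> b \<otimes> y) ` (PIdl g) \<subseteq> K"
  then have "c \<otimes> g \<otimes> y \<in> K" using cgenideal_self[OF c(2)] by blast
  then show "c \<otimes> (y \<otimes> g) \<in> K" using c by (simp add: m_ac)
next
  assume *: "c \<otimes> (y \<otimes> g) \<in> K"
  have "c \<otimes> (x \<otimes> g) \<otimes> y \<in> K" if "x \<in> carrier R" for x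
    using ideal.I_l_closed[OF K * that] that c by (simp add: m_ac)
  then show "(\<lambda>b. c \<otimes> b \<otimes> y) ` (PIdl g) \<subseteq> K" by (auto simp: cgenideal_def)
qed

lemma off_minimal_primes_mult:
  assumes "c \<in> off_minimal_primes R" "d \<in> off_minimal_primes R"
  shows "c \<otimes> d \<in> off_minimal_primes R"
  using assms unfolding off_minimal_primes_def minimal_prime_def
  by (auto dest: primeideal.I_prime)

lemma one_off_minimal_primes: "\<one> \<in> off_minimal_primes R"
  unfolding off_minimal_primes_def minimal_prime_def
  using primeideal.I_notcarr ideal.one_imp_carrier primeideal.axioms(1) by fastforce

lemma bracket_power_incl:
  assumes "ideal I R" "x \<in> I" shows "x [^] q \<in> bracket_power R I q"
  unfolding bracket_power_def using genideal_self[of "(\<lambda>i. i [^] q) ` I"] assms ideal.Icarr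
  by fastforce

lemma bracket_power_least:
  assumes "ideal K R" "\<And>x. x \<in> I \<Longrightarrow> x [^] q \<in> K" shows "bracket_power R I q \<subseteq> K"
  unfolding bracket_power_def using assms by (intro genideal_minimal) auto

lemma ideal_prod_mono:
  assumes "J \<subseteq> J'" shows "I \<cdot> J \<subseteq> I \<cdot> J'"
proof
  fix s assume "s \<in> I \<cdot> J"
  then show "s \<in> I \<cdot> J'"
    by induct (use assms in \<open>auto intro: ideal_prod.intros\<close>)
qed

lemma ideal_prod_least:
  assumes "ideal K R" "\<And>x y. x \<in> I \<Longrightarrow> y \<in> J \<Longrightarrow> x \<otimes> y \<in> K"
  shows "I \<cdot> J \<subseteq> K"
proof
  fix s assume "s \<in> I \<cdot> J"
  then show "s \<in> K"
    by induct (use assms additive_subgroup.a_closed[OF ideal.axioms(1)] in auto)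
qed

text \<open>Because f^q generates \<aa>^q and x^q f^q = (x f)^q, the same c and the same exponents
  serve x on the left and x f on the right.\<close>

lemma hy_closure_principal:
  assumes f: "f \<in> carrier R" and I: "ideal I R"
  shows "hy_closure R p (PIdl f) I = colon R (tight_closure R p I) f"
  unfolding hy_closure_def tight_closure_def colon_def
  using f by (auto simp: ideal_power_cgenideal principal_image_subset_iff bracket_power_ideal[OF I]
      off_minimal_primes_def nat_pow_distrib)

end

section \<open>Prime characteristic and the Frobenius homomorphism\<close>

locale prime_char_cring = cring R for R (structure) +
  fixes p :: nat
  assumes prime_p: "Factorial_Ring.prime p" and char_p: "ring_characteristic R = p"
begin

text \<open>The characteristic is the additive order of 1, so n times 1 vanishes when p divides n;
  then n x = (n 1) x.\<close>

lemma add_pow_char_multiple: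
  assumes "p dvd n" "x \<in> carrier R" shows "add_pow R n x = \<zero>"
proof -
  have "add_pow R n \<one> = \<zero>"
    using add.pow_eq_id[of \<one> n] assms(1) char_p by (simp add: ring_characteristic_def)
  then have "\<zero> = add_pow R n \<one> \<otimes> x" using assms by simp
  also have "\<dots> = add_pow R n x" using assms by (subst add_pow_ldistr) auto
  finally show ?thesis by simp
qed

text \<open>The case of exponent p is iterated e times.\<close>

lemma frobenius_add:
  assumes [simp]: "a \<in> carrier R" "b \<in> carrier R"
  shows "(a \<oplus> b) [^] (p ^ e) = a [^] (p ^ e) \<oplus> b [^] (p ^ e)"
proof (induction e)
  case 0
  show ?case by simp
next
  case (Suc e)
  have *: "(x \<oplus> y) [^] p = x [^] p \<oplus> y [^] p" if [simp]: "x \<in> carrier R" "y \<in> carrier R" for x y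
  proof -
    have p: "p > 0" using prime_p prime_gt_0_nat by blast
    let ?t = "\<lambda>k. add_pow R (p choose k) (x [^] k \<otimes> y [^] (p - k))"
    have "(x \<oplus> y) [^] p = (\<Oplus>k\<in>{..p}. ?t k)" by (rule binomial_expansion) simp_all
    \<comment> \<open>The prime p divides the binomial coefficient for 0 < k < p, so only the two
      end terms survive.\<close>
    also have "\<dots> = (\<Oplus>k\<in>{0, p}. ?t k)"
    proof (rule add.finprod_mono_neutral_cong_right)
      show "?t k = \<zero>" if "k \<in> {..p} - {0, p}" for k
        using that by (intro add_pow_char_multiple dvd_choose_prime prime_p) auto
    qed auto
    also have "\<dots> = x [^] p \<oplus> y [^] p" using p by (simp add: a_comm)
    finally show ?thesis .
  qed
  have "z [^] (p ^ Suc e) = (z [^] (p ^ e)) [^] p" if "z \<in> carrier R" for z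
    using that by (simp add: nat_pow_pow mult.commute)
  then show ?case by (simp add: Suc *)
qed

section \<open>Elements with a fixed multiplier and exponent, and the ideal property of the
  closure\<close>

definition left_witness :: "'a set \<Rightarrow> 'a set \<Rightarrow> 'a \<Rightarrow> nat \<Rightarrow> 'a set" where
  "left_witness \<aa> I c e = {x \<in> carrier R. \<forall>b\<in>ideal_power R \<aa> (p ^ e).
     c \<otimes> b \<otimes> x [^] (p ^ e) \<in> ideal_power R \<aa> (p ^ e) \<cdot> bracket_power R I (p ^ e)}"

lemma left_closure_iff:
  "x \<in> left_closure R p \<aa> I \<longleftrightarrow> x \<in> carrier R \<and>
     (\<exists>c\<in>off_minimal_primes R. \<forall>\<^sub>F e in sequentially. x \<in> left_witness \<aa> I c e)"
  by (auto simp: left_closure_def left_witness_def image_subset_iff)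

context
  fixes \<aa> I
  assumes \<aa>: "ideal \<aa> R" and I: "ideal I R"
begin

lemma ideal_pow_bracket: "ideal (ideal_power R \<aa> n \<cdot> bracket_power R I q) R"
  by (intro ideal_prod_is_ideal ideal_power_ideal bracket_power_ideal \<aa> I)

text \<open>Prime characteristic enters in the closure under sums, through additivity of x \<mapsto>
  x^q. For multiples, r^q is pulled out and absorbed by the target ideal.\<close>

lemma ideal_left_witness:
  assumes c: "c \<in> carrier R" shows "ideal (left_witness \<aa> I c e) R"
proof -
  let ?q = "p ^ e"
  let ?K = "ideal_power R \<aa> ?q \<cdot> bracket_power R I ?q"
  interpret K: ideal ?K R by (rule ideal_pow_bracket)
  have B: "b \<in> carrier R" if "b \<in> ideal_power R \<aa> ?q" for b
    using that ideal.Icarr[OF ideal_power_ideal[OF \<aa>]] by blast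
  show ?thesis
  proof (rule ideal_of_closed)
    \<comment> \<open>A positive exponent matters for the zero element, as 0^0 would be 1.\<close>
    have "?q \<noteq> 0" using prime_p by auto
    then show "\<zero> \<in> left_witness \<aa> I c e" using B c by (simp add: left_witness_def nat_pow_zero)
    show "x \<oplus> y \<in> left_witness \<aa> I c e"
      if "x \<in> left_witness \<aa> I c e" "y \<in> left_witness \<aa> I c e" for x y
      using that B c by (simp add: left_witness_def frobenius_add r_distr)
    show "r \<otimes> x \<in> left_witness \<aa> I c e" if "x \<in> left_witness \<aa> I c e" and r: "r \<in> carrier R" for x r
    proof -
      have x: "x \<in> carrier R" using that by (simp add: left_witness_def)
      have "c \<otimes> b \<otimes> (r \<otimes> x) [^] ?q \<in> ?K" if b: "b \<in> ideal_power R \<aa> ?q" for b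
      proof -
        have "c \<otimes> b \<otimes> (r \<otimes> x) [^] ?q = r [^] ?q \<otimes> (c \<otimes> b \<otimes> x [^] ?q)"
          using B[OF b] c x r by (simp add: nat_pow_distrib m_ac)
        then show ?thesis
          using \<open>x \<in> left_witness \<aa> I c e\<close> b r by (simp add: left_witness_def K.I_l_closed)
      qed
      then show ?thesis using x r by (simp add: left_witness_def)
    qed
  qed (auto simp: left_witness_def)
qed

text \<open>Allows different multipliers to be replaced by their product.\<close>

lemma left_witness_mult:
  assumes c: "c \<in> carrier R" and d: "d \<in> carrier R"
  shows "left_witness \<aa> I c e \<subseteq> left_witness \<aa> I (d \<otimes> c) e"
proof
  fix x assume x: "x \<in> left_witness \<aa> I c e"
  have "d \<otimes> c \<otimes> b \<otimes> x [^] (p ^ e) \<in> ideal_power R \<aa> (p ^ e) \<cdot> bracket_power R I (p ^ e)"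
    if b: "b \<in> ideal_power R \<aa> (p ^ e)" for b
  proof -
    have "d \<otimes> (c \<otimes> b \<otimes> x [^] (p ^ e)) \<in> ideal_power R \<aa> (p ^ e) \<cdot> bracket_power R I (p ^ e)"
      using x b d by (auto simp: left_witness_def intro!: ideal.I_l_closed[OF ideal_pow_bracket, of _ _ _ d])
    then show ?thesis
      using x c d ideal.Icarr[OF ideal_power_ideal[OF \<aa>] b] by (simp add: left_witness_def m_assoc)
  qed
  then show "x \<in> left_witness \<aa> I (d \<otimes> c) e" using x by (simp add: left_witness_def)
qed

text \<open>The product of the finitely many multipliers serves all elements of S, and finitely many
  eventual conditions hold simultaneously from some e on. The empty set takes the multiplier
  1.\<close>

lemma left_closure_uniform:
  assumes "finite S" "S \<subseteq> left_closure R p \<aa> I"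
  shows "\<exists>c\<in>off_minimal_primes R. \<forall>\<^sub>F e in sequentially. S \<subseteq> left_witness \<aa> I c e"
  using assms
proof (induction S)
  case empty
  show ?case using one_off_minimal_primes by auto
next
  case (insert x S)
  then obtain c d where c: "c \<in> off_minimal_primes R" and d: "d \<in> off_minimal_primes R"
    and ec: "\<forall>\<^sub>F e in sequentially. S \<subseteq> left_witness \<aa> I c e"
    and ed: "\<forall>\<^sub>F e in sequentially. x \<in> left_witness \<aa> I d e"
    by (auto simp: left_closure_iff)
  have cd: "c \<in> carrier R" "d \<in> carrier R" using c d by (auto simp: off_minimal_primes_def)
  have "\<forall>\<^sub>F e in sequentially. insert x S \<subseteq> left_witness \<aa> I (c \<otimes> d) e"
    using ec ed
  proof eventually_elim
    case (elim e)
    then show ?case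
      using left_witness_mult[OF cd, of e] left_witness_mult[OF cd(2,1), of e] cd
      by (auto simp: m_comm)
  qed
  then show ?case using off_minimal_primes_mult[OF c d] by blast
qed

lemma incl_left_closure: "I \<subseteq> left_closure R p \<aa> I"
proof
  fix x assume x: "x \<in> I"
  have "x \<in> left_witness \<aa> I \<one> e" for e
    using bracket_power_incl[OF I x] ideal.Icarr[OF I x] ideal.Icarr[OF ideal_power_ideal[OF \<aa>]]
    by (auto simp: left_witness_def intro: ideal_prod.prod)
  then show "x \<in> left_closure R p \<aa> I"
    using one_off_minimal_primes ideal.Icarr[OF I x] by (auto simp: left_closure_iff intro!: bexI[of _ \<one>])
qed

text \<open>Two elements come with their own multipliers, so a sum is handled by first finding a
  common one: for large e both summands then lie in the same \<open>left_witness\<close>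
  ideal.\<close>

lemma ideal_left_closure: "ideal (left_closure R p \<aa> I) R"
proof (rule ideal_of_closed)
  show "\<zero> \<in> left_closure R p \<aa> I"
    using incl_left_closure additive_subgroup.zero_closed[OF ideal.axioms(1)[OF I]] by blast
  show "x \<oplus> y \<in> left_closure R p \<aa> I"
    if x: "x \<in> left_closure R p \<aa> I" and y: "y \<in> left_closure R p \<aa> I" for x y
  proof -
    obtain c where c: "c \<in> off_minimal_primes R"
      and ec: "\<forall>\<^sub>F e in sequentially. {x, y} \<subseteq> left_witness \<aa> I c e"
      using left_closure_uniform[of "{x, y}"] x y by auto
    have "\<forall>\<^sub>F e in sequentially. x \<oplus> y \<in> left_witness \<aa> I c e"
      using ec
    proof eventually_elim
      case (elim e)
      then show ?case
        using ideal_left_witness[of c e] c additive_subgroup.a_closed[OF ideal.axioms(1)]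
        by (auto simp: off_minimal_primes_def)
    qed
    then show ?thesis using c x y by (auto simp: left_closure_iff)
  qed
  show "r \<otimes> x \<in> left_closure R p \<aa> I"
    if x: "x \<in> left_closure R p \<aa> I" and r: "r \<in> carrier R" for x r
  proof -
    obtain c where c: "c \<in> off_minimal_primes R"
      and ec: "\<forall>\<^sub>F e in sequentially. x \<in> left_witness \<aa> I c e"
      using x by (auto simp: left_closure_iff)
    have "\<forall>\<^sub>F e in sequentially. r \<otimes> x \<in> left_witness \<aa> I c e"
      using ec
      by eventually_elim
        (use c r in \<open>auto intro: ideal.I_l_closed[OF ideal_left_witness] simp: off_minimal_primes_def\<close>)
    then show ?thesis using c x r by (auto simp: left_closure_iff)
  qed
qed (auto simp: left_closure_def)

text \<open>Chains c \<aa>^q x^q \<subseteq> \<aa>^q J^[q] with d \<aa>^q J^[q] \<subseteq> \<aa>^q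
  I^[q]. The hypothesis on J speaks only of q-th powers of elements of J, so the second containment
  has to be extended to the ideal they generate.\<close>

lemma left_witness_trans:
  assumes J: "ideal J R" "J \<subseteq> left_witness \<aa> I d e"
    and cd: "c \<in> carrier R" "d \<in> carrier R"
  shows "left_witness \<aa> J c e \<subseteq> left_witness \<aa> I (d \<otimes> c) e"
proof
  let ?q = "p ^ e"
  let ?A = "ideal_power R \<aa> ?q"
  let ?K = "?A \<cdot> bracket_power R I ?q"
  fix x assume x: "x \<in> left_witness \<aa> J c e"
  have A: "b \<in> carrier R" if "b \<in> ?A" for b
    using that ideal.Icarr[OF ideal_power_ideal[OF \<aa>]] by blast
  have xc: "x \<in> carrier R" using x by (simp add: left_witness_def)
  \<comment> \<open>With d moved into the colon, products b y suffice as a test.\<close>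
  have "?A \<cdot> bracket_power R J ?q \<subseteq> colon R ?K d"
  proof (rule ideal_prod_least)
    show "ideal (colon R ?K d) R" by (intro ideal_colon ideal_pow_bracket cd)
    fix b y assume b: "b \<in> ?A" and y: "y \<in> bracket_power R J ?q"
    \<comment> \<open>For fixed b, moving d b into the colon reduces y to a generator z^q with z in
      J.\<close>
    have "bracket_power R J ?q \<subseteq> colon R ?K (d \<otimes> b)"
    proof (rule bracket_power_least)
      show "ideal (colon R ?K (d \<otimes> b)) R" using A[OF b] cd by (intro ideal_colon ideal_pow_bracket) auto
      show "z [^] ?q \<in> colon R ?K (d \<otimes> b)" if z: "z \<in> J" for z
      proof -
        have "z \<in> carrier R" "d \<otimes> b \<otimes> z [^] ?q \<in> ?K" using J z b by (auto simp: left_witness_def)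
        then show ?thesis using A[OF b] cd by (simp add: colon_def m_comm)
      qed
    qed
    then have "y \<in> carrier R" "y \<otimes> (d \<otimes> b) \<in> ?K" using y by (auto simp: colon_def)
    then show "b \<otimes> y \<in> colon R ?K d" using A[OF b] cd by (simp add: colon_def m_ac)
  qed
  then have "d \<otimes> c \<otimes> b \<otimes> x [^] ?q \<in> ?K" if b: "b \<in> ?A" for b
    using x b A[OF b] cd xc by (auto simp: left_witness_def colon_def m_ac)
  then show "x \<in> left_witness \<aa> I (d \<otimes> c) e" using xc by (simp add: left_witness_def)
qed

end

section \<open>Idempotence and monotonicity of the closure\<close>

lemma left_closure_idem:
  assumes R: "noetherian_ring R" and \<aa>: "ideal \<aa> R" and I: "ideal I R"
  shows "left_closure R p \<aa> (left_closure R p \<aa> I) = left_closure R p \<aa> I"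
proof (rule subset_antisym)
  let ?J = "left_closure R p \<aa> I"
  obtain S where S: "S \<subseteq> carrier R" "finite S" "?J = Idl S"
    using noetherian_ring.finetely_gen[OF R ideal_left_closure[OF \<aa> I]] by blast
  then obtain d where d: "d \<in> off_minimal_primes R"
    and ed: "\<forall>\<^sub>F e in sequentially. S \<subseteq> left_witness \<aa> I d e"
    using left_closure_uniform[OF \<aa> I, of S] genideal_self by metis
  have dc: "d \<in> carrier R" using d by (simp add: off_minimal_primes_def)
  \<comment> \<open>An ideal containing the generators S contains all of ?J, so d and the bound on e
    no longer depend on the element of ?J.\<close>
  have eJ: "\<forall>\<^sub>F e in sequentially. ?J \<subseteq> left_witness \<aa> I d e"
    using ed unfolding S(3)
    by eventually_elim (intro genideal_minimal ideal_left_witness \<aa> I dc)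
  show "left_closure R p \<aa> ?J \<subseteq> ?J"
  proof
    fix x assume x: "x \<in> left_closure R p \<aa> ?J"
    then obtain c where c: "c \<in> off_minimal_primes R"
      and ec: "\<forall>\<^sub>F e in sequentially. x \<in> left_witness \<aa> ?J c e"
      by (auto simp: left_closure_iff)
    have cc: "c \<in> carrier R" using c by (simp add: off_minimal_primes_def)
    have "\<forall>\<^sub>F e in sequentially. x \<in> left_witness \<aa> I (d \<otimes> c) e"
      using ec eJ
      by eventually_elim (use left_witness_trans[OF \<aa> I ideal_left_closure[OF \<aa> I] _ cc dc] in blast)
    then show "x \<in> ?J" using x off_minimal_primes_mult[OF d c] by (auto simp: left_closure_iff)
  qed
qed (rule incl_left_closure[OF \<aa> ideal_left_closure[OF \<aa> I]])

lemma left_closure_mono: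
  assumes "ideal J R" "I \<subseteq> J"
  shows "left_closure R p \<aa> I \<subseteq> left_closure R p \<aa> J"
proof -
  have "bracket_power R I q \<subseteq> bracket_power R J q" for q
    using bracket_power_ideal[OF assms(1)] bracket_power_incl[OF assms(1)] assms(2)
    by (intro bracket_power_least) auto
  then have "A \<cdot> bracket_power R I q \<subseteq> A \<cdot> bracket_power R J q" for A q
    by (rule ideal_prod_mono)
  then have *: "left_witness \<aa> I c e \<subseteq> left_witness \<aa> J c e" for c e
    by (auto simp: left_witness_def)
  show ?thesis
  proof
    fix x assume "x \<in> left_closure R p \<aa> I"
    then obtain c where x: "x \<in> carrier R" and c: "c \<in> off_minimal_primes R"
      and ec: "\<forall>\<^sub>F e in sequentially. x \<in> left_witness \<aa> I c e"
      by (auto simp: left_closure_iff)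
    from ec have "\<forall>\<^sub>F e in sequentially. x \<in> left_witness \<aa> J c e"
      by eventually_elim (use * in blast)
    then show "x \<in> left_closure R p \<aa> J" using x c by (auto simp: left_closure_iff)
  qed
qed

section \<open>Tight closure as the case of the unit ideal, and comparison of the closures\<close>

lemma ideal_tight_closure: "ideal I R \<Longrightarrow> ideal (tight_closure R p I) R"
  using ideal_left_closure[OF oneideal, of I] by (simp add: left_closure_carrier)

lemma tight_closure_incl: "ideal I R \<Longrightarrow> I \<subseteq> tight_closure R p I"
  using incl_left_closure[OF oneideal, of I] by (simp add: left_closure_carrier)

text \<open>The multiplier is kept: c b x^q is the product of b from \<aa>^q and c x^q from
  I^[q].\<close>

lemma tight_closure_subset_left_closure:
  assumes \<aa>: "ideal \<aa> R" and I: "ideal I R"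
  shows "tight_closure R p I \<subseteq> left_closure R p \<aa> I"
proof
  fix x assume "x \<in> tight_closure R p I"
  then obtain c where x: "x \<in> carrier R" and c: "c \<in> off_minimal_primes R"
    and ec: "\<forall>\<^sub>F e in sequentially. c \<otimes> x [^] (p ^ e) \<in> bracket_power R I (p ^ e)"
    by (auto simp: tight_closure_def)
  have cc: "c \<in> carrier R" using c by (simp add: off_minimal_primes_def)
  have "\<forall>\<^sub>F e in sequentially. x \<in> left_witness \<aa> I c e"
    using ec
  proof eventually_elim
    case (elim e)
    have "c \<otimes> b \<otimes> x [^] (p ^ e) \<in> ideal_power R \<aa> (p ^ e) \<cdot> bracket_power R I (p ^ e)"
      if b: "b \<in> ideal_power R \<aa> (p ^ e)" for b
    proof -
      have "c \<otimes> b \<otimes> x [^] (p ^ e) = b \<otimes> (c \<otimes> x [^] (p ^ e))"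
        using x cc ideal.Icarr[OF ideal_power_ideal[OF \<aa>] b] by (simp add: m_ac)
      then show ?thesis using ideal_prod.prod[OF b elim] by simp
    qed
    then show ?case using x by (simp add: left_witness_def)
  qed
  then show "x \<in> left_closure R p \<aa> I" using x c by (auto simp: left_closure_iff)
qed

text \<open>Only the target ideal grows, since a product of ideals lies in each factor.\<close>

lemma left_closure_subset_hy_closure:
  assumes \<aa>: "ideal \<aa> R" and I: "ideal I R"
  shows "left_closure R p \<aa> I \<subseteq> hy_closure R p \<aa> I"
proof -
  have le: "ideal_power R \<aa> q \<cdot> bracket_power R I q \<subseteq> bracket_power R I q" for q
    using ideal_prod_inter[OF ideal_power_ideal[OF \<aa>] bracket_power_ideal[OF I]] by blast
  have *: "\<forall>\<^sub>F e in sequentially. F e \<subseteq> bracket_power R I (p ^ e)"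
    if "\<forall>\<^sub>F e in sequentially. F e \<subseteq> ideal_power R \<aa> (p ^ e) \<cdot> bracket_power R I (p ^ e)" for F
    using that by eventually_elim (use le in blast)
  show ?thesis
    unfolding left_closure_def hy_closure_def using * by fast
qed

text \<open>Here \<aa>^q I^[q] = f^q I^[q], so testing with b = f^q gives c f^q x^q = f^q k with k
  in I^[q], and f^q cancels. The reverse inclusion holds for every ideal \<aa>.\<close>

lemma left_closure_principal_nonzerodivisor:
  assumes f: "nonzerodivisor R f" and I: "ideal I R"
  shows "left_closure R p (PIdl f) I = tight_closure R p I"
proof
  have fc: "f \<in> carrier R" using f by (simp add: nonzerodivisor_def)
  \<comment> \<open>One factor f is removed at a time, by applying the nonzerodivisor property to
    the difference of the two sides.\<close>
  have cancel_f: "x = y" if "f [^] n \<otimes> x = f [^] n \<otimes> y" "x \<in> carrier R" "y \<in> carrier R" for x y and n :: nat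
    using that(1)
  proof (induction n)
    case (Suc n)
    have "f \<otimes> (f [^] n \<otimes> x \<ominus> f [^] n \<otimes> y) = f [^] Suc n \<otimes> x \<ominus> f [^] Suc n \<otimes> y"
      using fc that by (simp add: minus_eq r_distr r_minus m_ac)
    also have "\<dots> = \<zero>" using Suc.prems fc that by simp
    finally have "f [^] n \<otimes> x \<ominus> f [^] n \<otimes> y = \<zero>"
      using f fc that by (simp add: nonzerodivisor_def)
    then show ?case using Suc.IH fc that by simp
  qed (use that in simp)
  show "left_closure R p (PIdl f) I \<subseteq> tight_closure R p I"
  proof
    fix x assume "x \<in> left_closure R p (PIdl f) I"
    then obtain c where x: "x \<in> carrier R" and c: "c \<in> off_minimal_primes R"
      and ec: "\<forall>\<^sub>F e in sequentially. x \<in> left_witness (PIdl f) I c e"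
      by (auto simp: left_closure_iff)
    have cc: "c \<in> carrier R" using c by (simp add: off_minimal_primes_def)
    have "\<forall>\<^sub>F e in sequentially. c \<otimes> x [^] (p ^ e) \<in> bracket_power R I (p ^ e)"
      using ec
    proof eventually_elim
      case (elim e)
      let ?g = "f [^] (p ^ e)"
      have "c \<otimes> ?g \<otimes> x [^] (p ^ e) \<in> (PIdl ?g) \<cdot> bracket_power R I (p ^ e)"
        using elim cgenideal_self fc by (simp add: left_witness_def ideal_power_cgenideal)
      then obtain k where k: "k \<in> bracket_power R I (p ^ e)" "c \<otimes> ?g \<otimes> x [^] (p ^ e) = ?g \<otimes> k"
        using fc by (auto simp: cgenideal_ideal_prod bracket_power_ideal[OF I])
      then have "?g \<otimes> (c \<otimes> x [^] (p ^ e)) = ?g \<otimes> k" using fc cc x by (simp add: m_ac)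
      then have "c \<otimes> x [^] (p ^ e) = k"
        by (rule cancel_f) (use cc x ideal.Icarr[OF bracket_power_ideal[OF I] k(1)] in simp_all)
      then show ?case using k by simp
    qed
    then show "x \<in> tight_closure R p I" using x c by (auto simp: tight_closure_def)
  qed
  show "tight_closure R p I \<subseteq> left_closure R p (PIdl f) I"
    by (rule tight_closure_subset_left_closure[OF cgenideal_ideal[OF fc] I])
qed

text \<open>Both closures are colon ideals by f, so a power of f can be sought that the second colon
  contains and the first does not.\<close>

lemma hy_closure_principal_not_idem:
  assumes I: "ideal I R" and fc: "f \<in> carrier R" and f: "f \<notin> tight_closure R p I"
    and n: "f [^] (n::nat) \<in> I"
  shows "hy_closure R p (PIdl f) (hy_closure R p (PIdl f) I) \<noteq> hy_closure R p (PIdl f) I"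
proof -
  let ?T = "tight_closure R p I"
  have T: "ideal ?T R" by (rule ideal_tight_closure[OF I])
  define m where "m = (LEAST m. f [^] (m::nat) \<in> ?T)"
  have "f [^] n \<in> ?T" using n tight_closure_incl[OF I] by blast
  then have m: "f [^] m \<in> ?T" unfolding m_def by (rule LeastI)
  \<comment> \<open>If m were 0, then 1 and hence f would lie in ?T; if m were 1, f itself would. So
    m is at least 2.\<close>
  have "m \<noteq> 0"
  proof
    assume "m = 0"
    then show False using m f fc ideal.one_imp_carrier[OF T] by simp
  qed
  moreover have "m \<noteq> 1" using m f fc by auto
  ultimately obtain k where k: "m = Suc (Suc k)" by (metis One_nat_def not0_implies_Suc)
  have "f [^] Suc k \<notin> ?T" using not_less_Least[of "Suc k" "\<lambda>m. f [^] m \<in> ?T"] k m_def by auto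
  then have "f [^] k \<notin> colon R ?T f" by (simp add: colon_def)
  moreover have "f [^] Suc k \<in> colon R ?T f" using m k fc by (simp add: colon_def)
  \<comment> \<open>Here k = m - 2, and f^(k+1) lies in ?T:f, hence in its tight closure.\<close>
  then have "f [^] k \<in> colon R (tight_closure R p (colon R ?T f)) f"
    using tight_closure_incl[OF ideal_colon[OF T fc]] fc by (auto simp: colon_def[of R _ f])
  ultimately show ?thesis
    using hy_closure_principal[OF fc I] hy_closure_principal[OF fc ideal_colon[OF T fc]] by auto
qed

end

text \<open>In (2), f is taken outside I^* and not merely outside I: for f in I^* the colon I^*:f is
  the whole ring, which the operation fixes.\<close>

theorem mainTheorem1:
  fixes R :: "('a, 'b) ring_scheme" and p :: nat and d :: enat
  assumes "cring R" and "noetherian_ring R"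
    and "Factorial_Ring.prime p" and "ring_characteristic R = p"
    and "krull_dim R = d" and "d > 0"
  shows
    "(\<forall>\<aa> I. ideal \<aa> R \<and> ideal I R \<longrightarrow>
        tight_closure R p I \<subseteq> left_closure R p \<aa> I \<and>
        left_closure R p \<aa> I \<subseteq> hy_closure R p \<aa> I)
     \<and>
     ((\<forall>f I. f \<in> carrier R \<and> ideal I R \<longrightarrow>
        hy_closure R p (PIdl\<^bsub>R\<^esub> f) I = colon R (tight_closure R p I) f) \<and>
      (\<forall>\<mm> f I. local_ring R \<mm> \<and> ideal I R \<and> primary_to R \<mm> I \<and> f \<in> \<mm> - tight_closure R p I \<longrightarrow>
        hy_closure R p (PIdl\<^bsub>R\<^esub> f) (hy_closure R p (PIdl\<^bsub>R\<^esub> f) I) \<noteq> hy_closure R p (PIdl\<^bsub>R\<^esub> f) I))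
     \<and>
     (\<forall>f I. nonzerodivisor R f \<and> ideal I R \<longrightarrow>
        left_closure R p (PIdl\<^bsub>R\<^esub> f) I = tight_closure R p I)
     \<and>
     ((\<forall>\<aa> I. ideal \<aa> R \<and> ideal I R \<longrightarrow>
        left_closure R p \<aa> (left_closure R p \<aa> I) = left_closure R p \<aa> I) \<and>
      (\<forall>\<aa>. ideal \<aa> R \<longrightarrow> closure_operation R (left_closure R p \<aa>)))"
proof -
  interpret prime_char_cring R p
    using assms by (simp add: prime_char_cring_def prime_char_cring_axioms_def)
  note noeth = \<open>noetherian_ring R\<close>
  show ?thesis
  proof (intro conjI allI impI)
    fix \<mm> f I
    assume H: "local_ring R \<mm> \<and> ideal I R \<and> primary_to R \<mm> I \<and> f \<in> \<mm> - tight_closure R p I"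
    \<comment> \<open>The radical of I is \<mm>, so some power of f lies in I.\<close>
    then obtain n :: nat where "f \<in> carrier R" "f [^]\<^bsub>R\<^esub> n \<in> I"
      by (auto simp: primary_to_def ideal_radical_def)
    then show "hy_closure R p (PIdl\<^bsub>R\<^esub> f) (hy_closure R p (PIdl\<^bsub>R\<^esub> f) I) \<noteq> hy_closure R p (PIdl\<^bsub>R\<^esub> f) I"
      using H by (intro hy_closure_principal_not_idem) auto
  next
    fix \<aa> assume \<aa>: "ideal \<aa> R"
    show "closure_operation R (left_closure R p \<aa>)"
      unfolding closure_operation_def
      using ideal_left_closure[OF \<aa>] incl_left_closure[OF \<aa>] left_closure_idem[OF noeth \<aa>]
        left_closure_mono by auto
  qed (use tight_closure_subset_left_closure left_closure_subset_hy_closure hy_closure_principal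
      left_closure_principal_nonzerodivisor left_closure_idem[OF noeth] in auto)
qed

end
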